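(* Let $\widehat{G}$ be a second countable locally compact abelian group with Haar measure $\nu_{\widehat{G}}$, let $\Gamma^\perp$ be a discrete subgroup of $\widehat{G}$, and let $\widehat{\alpha}\in\mathrm{Aut}(\widehat{G})$. Let $\Omega\subset\widehat{G}$ be any $\nu_{\widehat{G}}$-measurable section of $\widehat{G}/\Gamma^\perp$ and, for $r>0$, let $$\Omega^r_{\widehat{\alpha}}=\Omega\cap\bigcup_{\lambda\in\Gamma^\perp}\big(\widehat{\alpha}B(\mathrm{e},r)+\lambda\big).$$ Then $$\sharp\big(\Gamma^\perp\cap\widehat{\alpha}B(\mathrm{e},r)\big)\le\frac{1}{\nu_{\widehat{G}}(\Omega^r_{\widehat{\alpha}})}\,\nu_{\widehat{G}}\big(\widehat{\alpha}B(\mathrm{e},2r)\big)\qquad\forall\ r>0.$$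
   Context: $\widehat{G}$ is written additively with identity $\mathrm{e}$ and is endowed with a translation-invariant metric $d_{\widehat{G}}$ inducing its topology and whose closed balls are compact; $B(\xi_0,r)=\{\xi\in\widehat{G}:d_{\widehat{G}}(\xi,\xi_0)<r\}$. $\mathrm{Aut}(\widehat{G})$ denotes topological group automorphisms. A measurable section (fundamental set) $\Omega$ of $\widehat{G}/\Gamma^\perp$ is a measurable set containing exactly one representative of each coset of $\Gamma^\perp$. $\sharp$ denotes cardinality. *)

theory Defs
  imports "HOL-Analysis.Analysis"
begin

text \<open>Haar measures are Borel measures here; ``measurable with respect to a Haar measure'' is
  expressed by membership in the sets of its completion.\<close>

definition haar_measure :: "'a::{topological_ab_group_add, t2_space} measure \<Rightarrow> bool" where
  "haar_measure \<nu> \<longleftrightarrow>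
     sets \<nu> = sets borel \<and>
     emeasure \<nu> UNIV \<noteq> 0 \<and>
     (\<forall>x. \<forall>A\<in>sets borel. emeasure \<nu> ((+) x ` A) = emeasure \<nu> A) \<and>
     (\<forall>K. compact K \<longrightarrow> emeasure \<nu> K < \<infinity>) \<and>
     (\<forall>A\<in>sets borel. emeasure \<nu> A = (INF U\<in>{U. open U \<and> A \<subseteq> U}. emeasure \<nu> U)) \<and>
     (\<forall>U. open U \<longrightarrow> emeasure \<nu> U = (SUP K\<in>{K. compact K \<and> K \<subseteq> U}. emeasure \<nu> K))"

definition add_subgroup :: "'a::group_add set \<Rightarrow> bool" where
  "add_subgroup \<Lambda> \<longleftrightarrow>
     0 \<in> \<Lambda> \<and> (\<forall>x\<in>\<Lambda>. \<forall>y\<in>\<Lambda>. x + y \<in> \<Lambda>) \<and> (\<forall>x\<in>\<Lambda>. - x \<in> \<Lambda>)"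

definition top_group_aut :: "('a::topological_ab_group_add \<Rightarrow> 'a) \<Rightarrow> bool" where
  "top_group_aut \<alpha> \<longleftrightarrow>
     (\<forall>x y. \<alpha> (x + y) = \<alpha> x + \<alpha> y) \<and> (\<exists>\<beta>. homeomorphism UNIV UNIV \<alpha> \<beta>)"

definition measurable_section ::
    "'a::ab_group_add measure \<Rightarrow> 'a set \<Rightarrow> 'a set \<Rightarrow> bool" where
  "measurable_section \<nu> \<Lambda> \<Omega> \<longleftrightarrow>
     \<Omega> \<in> sets (completion \<nu>) \<and> (\<forall>x. \<exists>!\<omega>. \<omega> \<in> \<Omega> \<inter> (+) x ` \<Lambda>)"

definition section_part ::
    "('a \<Rightarrow> 'a) \<Rightarrow> 'a set \<Rightarrow> 'a set \<Rightarrow> real \<Rightarrow> 'a::{ab_group_add, metric_space} set" where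
  "section_part \<alpha> \<Lambda> \<Omega> r = \<Omega> \<inter> (\<Union>l\<in>\<Lambda>. (\<lambda>x. x + l) ` (\<alpha> ` ball 0 r))"

end

theory Submission
  imports Defs
begin

text \<open>The part of the section meeting \<open>\<alpha> B(e,r) + \<Lambda>\<close> is cut into countably many Borel pieces, each
  contained in a single translate \<open>\<alpha> B(e,r) + l\<close>. Moving every piece back by its \<open>l\<close> gives a subset \<open>T\<close>
  of \<open>\<alpha> B(e,r)\<close> of the same measure that still meets each coset of \<open>\<Lambda>\<close> at most once. The translates
  of \<open>T\<close> by the elements of \<open>\<Lambda> \<inter> \<alpha> B(e,r)\<close> are therefore disjoint, and they all lie in
  \<open>\<alpha> B(e,r) + \<alpha> B(e,r) \<subseteq> \<alpha> B(e,2r)\<close>. The common measure of these translates is nonzero because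
  countably many translates of the section part cover the nonempty open set \<open>\<alpha> B(e,r)\<close>.\<close>

text \<open>Each point is isolated by some basic open set, and that set determines the point, so
  \<open>S\<close> injects into a countable basis. This is what allows \<Lambda> to be
  enumerated.\<close>

lemma countable_discrete:
  fixes S :: "'a::second_countable_topology set"
  assumes "discrete S"
  shows "countable S"
proof -
  obtain \<B> :: "'a set set" where \<B>: "countable \<B>" "topological_basis \<B>"
    using ex_countable_basis by blast
  have "\<exists>B\<in>\<B>. B \<inter> S = {x}" if x: "x \<in> S" for x
  proof -
    obtain V where V: "open V" "V \<inter> S = {x}"
      using discreteD[OF assms x] by (auto simp: isolated_in_def)
    then obtain B where "B \<in> \<B>" "x \<in> B" "B \<subseteq> V"
      using topological_basisE[OF \<B>(2) V(1)] by blast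
    with V x show ?thesis by blast
  qed
  then obtain B where B: "\<And>x. x \<in> S \<Longrightarrow> B x \<in> \<B> \<and> B x \<inter> S = {x}"
    by metis
  then have "inj_on B S"
    by (intro inj_onI) (metis singleton_inject)
  moreover have "countable (B ` S)"
    using B by (intro countable_subset[OF _ \<B>(1)]) blast
  ultimately show ?thesis
    by (rule countable_image_inj_on[rotated])
qed

section \<open>Translates of open and Borel sets\<close>

lemma image_plus_eq_vimage: "(+) x ` A = (+) (- x) -` A" for x :: "'a::group_add"
proof safe
  fix y assume "- x + y \<in> A"
  then show "y \<in> (+) x ` A"
    by (intro image_eqI[of _ _ "- x + y"]) auto
qed auto

lemma open_image_plus: "open A \<Longrightarrow> open ((+) x ` A)" for x :: "'a::topological_group_add"
  unfolding image_plus_eq_vimage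
  by (erule open_vimage) (intro continuous_intros)

lemma borel_image_plus: "A \<in> sets borel \<Longrightarrow> (+) x ` A \<in> sets borel"
  for x :: "'a::{topological_group_add, t2_space}"
proof -
  have meas: "(+) (- x) \<in> borel_measurable borel"
    by (intro borel_measurable_continuous_onI continuous_intros)
  then show "(+) x ` A \<in> sets borel" if "A \<in> sets borel"
    using measurable_sets[OF meas that] unfolding image_plus_eq_vimage by simp
qed

section \<open>Positivity and packing for a Haar measure\<close>

context
  fixes \<nu> :: "'a::{topological_ab_group_add, t2_space, second_countable_topology} measure"
  assumes haar: "haar_measure \<nu>"
begin

lemma haar_sets: "sets \<nu> = sets borel"
  and haar_nonzero: "emeasure \<nu> UNIV \<noteq> 0"
  and haar_invariant: "A \<in> sets borel \<Longrightarrow> emeasure \<nu> ((+) x ` A) = emeasure \<nu> A"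
  and haar_compact: "compact K \<Longrightarrow> emeasure \<nu> K < \<infinity>"
proof -
  note * = haar[unfolded haar_measure_def]
  show "sets \<nu> = sets borel"
    by (rule conjunct1[OF *])
  show "emeasure \<nu> UNIV \<noteq> 0"
    by (rule conjunct1[OF conjunct2[OF *]])
  show "emeasure \<nu> ((+) x ` A) = emeasure \<nu> A" if "A \<in> sets borel" for x A
    using conjunct1[OF conjunct2[OF conjunct2[OF *]]] that by blast
  show "emeasure \<nu> K < \<infinity>" if "compact K" for K
    using conjunct1[OF conjunct2[OF conjunct2[OF conjunct2[OF *]]]] that by blast
qed

lemma haar_null_image_plus: "N \<in> null_sets \<nu> \<Longrightarrow> (+) x ` N \<in> null_sets \<nu>"
  by (auto simp: null_sets_def haar_sets haar_invariant borel_image_plus)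

text \<open>Every translate of a null set is null. By the Lindelof property countably many
  translates of \<open>U\<close> already cover the group, which would then be null.\<close>

lemma haar_open_nonzero:
  assumes "open U" "U \<noteq> {}"
  shows "emeasure \<nu> U \<noteq> 0"
proof
  assume "emeasure \<nu> U = 0"
  then have U: "U \<in> null_sets \<nu>"
    using assms by (auto simp: null_sets_def haar_sets)
  have "open A" if "A \<in> range (\<lambda>x. (+) x ` U)" for A
    using that open_image_plus[OF assms(1)] by blast
  from Lindelof[OF this]
  obtain \<F> where \<F>: "\<F> \<subseteq> range (\<lambda>x. (+) x ` U)" "countable \<F>"
      "\<Union>\<F> = (\<Union>x. (+) x ` U)"
    by blast
  have "(\<Union>x. (+) x ` U) = UNIV"
  proof -
    obtain u where "u \<in> U" using assms by blast
    then have "y \<in> (+) (y - u) ` U" for y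
      by (intro image_eqI[of _ _ u]) auto
    then show ?thesis by blast
  qed
  moreover have "(\<Union>A\<in>\<F>. A) \<in> null_sets \<nu>"
  proof (rule null_sets_UN'[OF \<F>(2)])
    fix A assume "A \<in> \<F>"
    then obtain x where "A = (+) x ` U"
      using \<F>(1) by blast
    then show "A \<in> null_sets \<nu>"
      using haar_null_image_plus[OF U] by simp
  qed
  ultimately show False
    using haar_nonzero \<F>(3) by (simp add: null_sets_def)
qed

text \<open>Ensures that the final bound does not divide by zero. A null set of the completion is
  first enclosed in a Borel null set \<open>N\<close>, because invariance is known for Borel
  sets.\<close>

lemma haar_translates_cover_nonzero:
  assumes S: "S \<in> sets (completion \<nu>)" and "countable \<Lambda>"
    and U: "open U" "U \<noteq> {}" "U \<subseteq> (\<Union>l\<in>\<Lambda>. (+) l ` S)"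
  shows "emeasure (completion \<nu>) S \<noteq> 0"
proof
  assume "emeasure (completion \<nu>) S = 0"
  with S have "S \<in> null_sets (completion \<nu>)"
    by blast
  then obtain N where N: "N \<in> null_sets \<nu>" "S \<subseteq> N"
    unfolding null_sets_completion_iff2 by blast
  have null: "(\<Union>l\<in>\<Lambda>. (+) l ` N) \<in> null_sets \<nu>"
    using \<open>countable \<Lambda>\<close> by (intro null_sets_UN' haar_null_image_plus N)
  have "U \<in> null_sets \<nu>"
  proof (rule null_sets_subset[OF null])
    show "U \<in> sets \<nu>"
      using U(1) by (simp add: haar_sets)
    show "U \<subseteq> (\<Union>l\<in>\<Lambda>. (+) l ` N)"
      using U(3) N(2) by blast
  qed
  then show False
    using haar_open_nonzero[OF U(1,2)] by auto
qed

text \<open>The counting inequality, stated for finite \<open>F\<close> because the finiteness of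
  \<Lambda> \<inter> U is itself deduced from it.\<close>

lemma haar_packing:
  assumes \<Lambda>: "add_subgroup \<Lambda>" "countable \<Lambda>"
    and U: "open U" and V: "V \<in> sets borel" "\<And>x y. x \<in> U \<Longrightarrow> y \<in> U \<Longrightarrow> x + y \<in> V"
    and S: "S \<in> sets borel" "S \<subseteq> (\<Union>l\<in>\<Lambda>. (+) l ` U)"
    and inj: "\<And>s t. s \<in> S \<Longrightarrow> t \<in> S \<Longrightarrow> s - t \<in> \<Lambda> \<Longrightarrow> s = t"
    and F: "finite F" "F \<subseteq> \<Lambda> \<inter> U"
  shows "of_nat (card F) * emeasure \<nu> S \<le> emeasure \<nu> V"
proof -
  have add: "x + y \<in> \<Lambda>" if "x \<in> \<Lambda>" "y \<in> \<Lambda>" for x y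
    using \<Lambda>(1) that by (simp add: add_subgroup_def)
  have diff: "x - y \<in> \<Lambda>" if "x \<in> \<Lambda>" "y \<in> \<Lambda>" for x y
    using add[of x "- y"] \<Lambda>(1) that by (simp add: add_subgroup_def)
  have "\<Lambda> \<noteq> {}"
    using \<Lambda>(1) by (auto simp: add_subgroup_def)
  then obtain e :: "nat \<Rightarrow> 'a" where e: "range e = \<Lambda>"
    using \<Lambda>(2) by (metis range_from_nat_into)
  \<comment> \<open>Each point of \<open>S\<close> goes to the first \<open>n\<close> whose
    translate of \<open>U\<close> contains it. If \<open>e\<close> repeats a value, the later piece
    is empty.\<close>
  define D where "D = disjointed (\<lambda>n. S \<inter> (+) (e n) ` U)"
  have D_sub: "D n \<subseteq> S" "D n \<subseteq> (+) (e n) ` U" for n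
    using disjointed_subset[of "\<lambda>n. S \<inter> (+) (e n) ` U" n] by (auto simp: D_def)
  have "range (\<lambda>n. S \<inter> (+) (e n) ` U) \<subseteq> sets borel"
    using S(1) open_image_plus[OF U] by auto
  from sets.range_disjointed_sets[OF this] have D_sets: "D n \<in> sets borel" for n
    unfolding D_def by blast
  have D_disj: "disjoint_family D"
    unfolding D_def by (rule disjoint_family_disjointed)
  have D_UN: "(\<Union>n. D n) = S"
    using S(2) unfolding D_def UN_disjointed_eq e[symmetric] by blast
  \<comment> \<open>Used twice: with \<open>l = l'\<close> the pieces forming one \<open>T l\<close>
    are disjoint, and with different \<open>l\<close> the sets \<open>T l\<close> are disjoint from
    each other.\<close>
  have D_eq: "n = m \<and> l = l'"
    if "l \<in> \<Lambda>" "l' \<in> \<Lambda>" "x \<in> (+) (l - e n) ` D n" "x \<in> (+) (l' - e m) ` D m" for l l' n m x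
  proof -
    obtain s t where s: "s \<in> D n" "x = l - e n + s" and t: "t \<in> D m" "x = l' - e m + t"
      using \<open>x \<in> (+) (l - e n) ` D n\<close> \<open>x \<in> (+) (l' - e m) ` D m\<close> by blast
    then have "s - t = (l' - l) + (e n - e m)"
      by (simp add: algebra_simps)
    then have "s - t \<in> \<Lambda>"
      using that(1,2) e by (metis add diff rangeI)
    then have "s = t"
      using inj s(1) t(1) D_sub(1) by blast
    moreover from this have "n = m"
      using D_disj s(1) t(1) by (auto simp: disjoint_family_on_def)
    ultimately show ?thesis
      using s t by simp
  qed
  \<comment> \<open>\<open>T 0\<close> is the rearranged copy of \<open>S\<close> inside
    \<open>U\<close>, and \<open>T l\<close> is its translate by \<open>l\<close>.\<close>
  define T where "T l = (\<Union>n. (+) (l - e n) ` D n)" for l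
  have T_sets: "T l \<in> sets \<nu>" for l
    unfolding T_def haar_sets by (intro sets.countable_UN) (use borel_image_plus[OF D_sets] in blast)
  have "emeasure \<nu> (T l) = emeasure \<nu> S" if "l \<in> \<Lambda>" for l
  proof -
    have "disjoint_family (\<lambda>n. (+) (l - e n) ` D n)"
      using D_eq[OF that that] unfolding disjoint_family_on_def by blast
    then have "emeasure \<nu> (T l) = (\<Sum>n. emeasure \<nu> ((+) (l - e n) ` D n))"
      unfolding T_def by (intro suminf_emeasure[symmetric]) (auto simp: haar_sets borel_image_plus D_sets)
    also have "\<dots> = (\<Sum>n. emeasure \<nu> (D n))"
      by (simp add: haar_invariant D_sets)
    also have "\<dots> = emeasure \<nu> S"
      using D_disj by (subst suminf_emeasure) (auto simp: haar_sets D_sets D_UN)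
    finally show ?thesis .
  qed
  then have "of_nat (card F) * emeasure \<nu> S = (\<Sum>l\<in>F. emeasure \<nu> (T l))"
    using F by (simp add: subset_iff)
  also have "\<dots> = emeasure \<nu> (\<Union>l\<in>F. T l)"
  proof (rule sum_emeasure)
    show "disjoint_family_on T F"
      using D_eq F(2) unfolding disjoint_family_on_def T_def by blast
  qed (use F T_sets in auto)
  also have "\<dots> \<le> emeasure \<nu> V"
  proof (rule emeasure_mono)
    show "(\<Union>l\<in>F. T l) \<subseteq> V"
    proof
      fix x assume "x \<in> (\<Union>l\<in>F. T l)"
      \<comment> \<open>Cancelling \<open>e n\<close> leaves \<open>x = l + u\<close> with both
        \<open>l\<close> and \<open>u\<close> in \<open>U\<close>.\<close>
      then obtain l n s where "l \<in> F" "s \<in> D n" "x = l - e n + s"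
        unfolding T_def by blast
      moreover from this obtain u where "u \<in> U" "s = e n + u"
        using D_sub(2) by blast
      ultimately show "x \<in> V"
        using V(2)[of l u] F(2) by auto
    qed
  qed (simp add: haar_sets V)
  finally show ?thesis .
qed

end

section \<open>Application to the part of the section near the subgroup\<close>

theorem lemma2:
  fixes \<nu> :: "'a::{topological_ab_group_add, metric_space, second_countable_topology} measure"
    and \<Lambda> \<Omega> :: "'a set"
    and \<alpha> :: "'a \<Rightarrow> 'a"
  assumes "locally compact (UNIV :: 'a set)"
    and "\<And>x y z :: 'a. dist (x + z) (y + z) = dist x y"
    and "\<And>(x :: 'a) s. compact (cball x s)"
    and "haar_measure \<nu>"
    and "add_subgroup \<Lambda>"
    and "discrete \<Lambda>"
    and "top_group_aut \<alpha>"
    and "measurable_section \<nu> \<Lambda> \<Omega>"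
  shows "\<forall>r>0. finite (\<Lambda> \<inter> \<alpha> ` ball 0 r) \<and>
           real (card (\<Lambda> \<inter> \<alpha> ` ball 0 r))
             \<le> 1 / measure (completion \<nu>) (section_part \<alpha> \<Lambda> \<Omega> r)
               * measure \<nu> (\<alpha> ` ball 0 (2 * r))"
proof (intro allI impI)
  fix r :: real assume r: "r > 0"
  note haar = \<open>haar_measure \<nu>\<close>
  obtain \<beta> where add: "\<And>x y. \<alpha> (x + y) = \<alpha> x + \<alpha> y" and hom: "homeomorphism UNIV UNIV \<alpha> \<beta>"
    using \<open>top_group_aut \<alpha>\<close> unfolding top_group_aut_def by blast
  have cont: "continuous_on UNIV \<alpha>"
    using hom by (rule homeomorphism_cont1)
  have open_image: "open (\<alpha> ` A)" if "open A" for A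
    using homeomorphism_imp_open_map[OF hom, of A] that by simp
  have "\<alpha> 0 = 0"
    using add[of 0 0] by simp
  define U V S where "U = \<alpha> ` ball 0 r" and "V = \<alpha> ` ball 0 (2 * r)" and "S = section_part \<alpha> \<Lambda> \<Omega> r"
  have U: "open U" "U \<noteq> {}" and zero: "0 \<in> U" and V: "V \<in> sets borel"
    using r \<open>\<alpha> 0 = 0\<close> by (force simp: U_def V_def open_image image_iff)+
  \<comment> \<open>Additivity of \<alpha> reduces this to balls, where translation invariance of
    the metric and the triangle inequality suffice.\<close>
  have UV: "x + y \<in> V" if "x \<in> U" "y \<in> U" for x y
  proof -
    obtain a b where ab: "x = \<alpha> a" "y = \<alpha> b" "dist 0 a < r" "dist 0 b < r"
      using \<open>x \<in> U\<close> \<open>y \<in> U\<close> by (auto simp: U_def)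
    have "dist b (a + b) = dist 0 a"
      using assms(2)[of 0 b a] by simp
    then have "dist 0 (a + b) < 2 * r"
      using dist_triangle[of 0 "a + b" b] ab by simp
    then show ?thesis
      using ab add unfolding V_def by (intro image_eqI[of _ _ "a + b"]) auto
  qed
  have V_fin: "emeasure \<nu> V < \<infinity>"
  proof -
    have K: "compact (\<alpha> ` cball 0 (2 * r))"
      using assms(3) cont by (blast intro: compact_continuous_image continuous_on_subset)
    moreover have "V \<subseteq> \<alpha> ` cball 0 (2 * r)"
      unfolding V_def by (intro image_mono) auto
    ultimately have "emeasure \<nu> V \<le> emeasure \<nu> (\<alpha> ` cball 0 (2 * r))"
      by (intro emeasure_mono) (auto simp: haar_sets[OF haar] borel_compact)
    then show ?thesis
      using haar_compact[OF haar K] by (rule order.strict_trans1)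
  qed

  have \<Lambda>: "countable \<Lambda>" "0 \<in> \<Lambda>" "\<And>x. x \<in> \<Lambda> \<Longrightarrow> - x \<in> \<Lambda>"
    using assms(5,6) by (auto simp: countable_discrete add_subgroup_def)
  have \<Omega>: "\<Omega> \<in> sets (completion \<nu>)" "\<And>x. \<exists>!\<omega>. \<omega> \<in> \<Omega> \<inter> (+) x ` \<Lambda>"
    using assms(8) by (auto simp: measurable_section_def)
  have S_eq: "S = \<Omega> \<inter> (\<Union>l\<in>\<Lambda>. (+) l ` U)"
    unfolding S_def section_part_def U_def by (simp add: add.commute)
  have S: "S \<in> sets (completion \<nu>)"
  proof -
    have "open (\<Union>l\<in>\<Lambda>. (+) l ` U)"
      by (intro open_UN ballI open_image_plus U)
    then show ?thesis
      unfolding S_eq by (intro sets.Int \<Omega>) (auto simp: haar_sets[OF haar])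
  qed
  \<comment> \<open>Both points represent the coset of \<open>t\<close>, and \<Omega> has only one
    representative there.\<close>
  have S_inj: "s = t" if "s \<in> S" "t \<in> S" "s - t \<in> \<Lambda>" for s t
  proof -
    have "s \<in> (+) t ` \<Lambda>"
      using that(3) by (intro image_eqI[of _ _ "s - t"]) auto
    moreover have "t \<in> (+) t ` \<Lambda>"
      using \<Lambda>(2) by (intro image_eqI[of _ _ 0]) auto
    ultimately show ?thesis
      using \<Omega>(2)[of t] that(1,2) unfolding S_eq by blast
  qed
  \<comment> \<open>The representative \<open>u + l\<close> of the coset of \<open>u\<close> lies in
    \<open>S\<close>, and translating by \<open>- l\<close> recovers \<open>u\<close>.\<close>
  have "U \<subseteq> (\<Union>l\<in>\<Lambda>. (+) l ` S)"
  proof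
    fix u assume "u \<in> U"
    obtain l where l: "l \<in> \<Lambda>" "u + l \<in> \<Omega>"
      using \<Omega>(2)[of u] by blast
    then have "u + l \<in> S"
      unfolding S_eq using \<open>u \<in> U\<close> by (auto simp: add.commute)
    then have "u \<in> (+) (- l) ` S"
      by (intro image_eqI[of _ _ "u + l"]) auto
    then show "u \<in> (\<Union>l\<in>\<Lambda>. (+) l ` S)"
      using \<Lambda>(3)[OF l(1)] by blast
  qed
  then have S_nonzero: "emeasure (completion \<nu>) S \<noteq> 0"
    by (intro haar_translates_cover_nonzero[OF haar S \<Lambda>(1) U])

  have packing: "of_nat (card F) * emeasure (completion \<nu>) S \<le> emeasure \<nu> V"
    if "finite F" "F \<subseteq> \<Lambda> \<inter> U" for F
  proof -
    \<comment> \<open>\<open>S\<close> is measurable only for the completion, so packing is applied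
      to its Borel main part, a subset of the same measure.\<close>
    have sub: "main_part \<nu> S \<subseteq> S"
      using main_part_null_part_Un[OF S] by blast
    show ?thesis
      unfolding emeasure_completion[OF S]
    proof (rule haar_packing[OF haar \<open>add_subgroup \<Lambda>\<close> \<Lambda>(1) U(1) V UV _ _ _ that])
      show "main_part \<nu> S \<in> sets borel"
        using main_part_sets[OF S] by (simp only: haar_sets[OF haar])
      show "main_part \<nu> S \<subseteq> (\<Union>l\<in>\<Lambda>. (+) l ` U)"
        using sub S_eq by blast
      show "s = t" if "s \<in> main_part \<nu> S" "t \<in> main_part \<nu> S" "s - t \<in> \<Lambda>" for s t
        using S_inj sub that by blast
    qed
  qed
  \<comment> \<open>The singleton of \<open>0\<close> bounds the measure of \<open>S\<close> by that
    of \<open>V\<close>. Finiteness matters: \<open>measure\<close> gives 0 on sets of infinite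
    measure, and division by 0 gives 0.\<close>
  have S_fin: "emeasure (completion \<nu>) S < \<infinity>"
    using packing[of "{0}"] zero \<Lambda>(2) V_fin by (auto intro: order.strict_trans1)
  define m where "m = measure (completion \<nu>) S"
  have m: "emeasure (completion \<nu>) S = ennreal m"
    using S_fin by (simp add: m_def emeasure_eq_ennreal_measure)
  have "m > 0"
    using S_nonzero unfolding m by (metis ennreal_neg not_le)
  have bound: "real (card F) \<le> 1 / m * measure \<nu> V" if "finite F" "F \<subseteq> \<Lambda> \<inter> U" for F
  proof -
    have "ennreal (real (card F) * m) \<le> ennreal (measure \<nu> V)"
      using packing[OF that] V_fin \<open>m > 0\<close> unfolding m
      by (simp add: emeasure_eq_ennreal_measure ennreal_mult ennreal_of_nat_eq_real_of_nat)
    then show ?thesis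
      using \<open>m > 0\<close> by (simp add: field_simps)
  qed
  \<comment> \<open>The bound on \<open>card F\<close> is the same for all finite subsets, so the
    whole set is finite and may itself serve as \<open>F\<close>.\<close>
  have "finite (\<Lambda> \<inter> U)"
  proof (rule conjunct1[OF finite_if_finite_subsets_card_bdd])
    fix F assume "F \<subseteq> \<Lambda> \<inter> U" "finite F"
    then show "card F \<le> nat \<lfloor>1 / m * measure \<nu> V\<rfloor>"
      using bound by (simp add: le_nat_floor)
  qed
  with bound[of "\<Lambda> \<inter> U"] show "finite (\<Lambda> \<inter> \<alpha> ` ball 0 r) \<and>
      real (card (\<Lambda> \<inter> \<alpha> ` ball 0 r))
        \<le> 1 / measure (completion \<nu>) (section_part \<alpha> \<Lambda> \<Omega> r)
          * measure \<nu> (\<alpha> ` ball 0 (2 * r))"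
    by (simp add: U_def V_def S_def m_def)
qed

end
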